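(* For every rational number $r\geq 1/2$ and every integer $k\geq 1$, $$\mathcal{T}_{1/2,k}(q)\succeq_q \mathcal{T}_{r,k}(q).$$
   Context: For $n\ge 0$, $(z;q)_n:=\prod_{j=0}^{n-1}(1-zq^j)$, with $(z;q)_0:=1$. Let $\mathcal{P}:=\bigcup_{M\geq 1}\mathbb{Q}[[q^{1/M}]]$ be the directed union of the rings of fractional power series (exponents are nonnegative rationals with a common denominator). If $F(q)=\sum_{\alpha\in\frac1M\mathbb{Z}_{\ge0}}c(\alpha)q^\alpha\in\mathcal{P}$, its integer trace is $\operatorname{Tr}_{\mathbb{Z}}(F):=\sum_{n\geq 0}c(n)q^n\in\mathbb{Q}[[q]]$, the sum running over integers $n\ge 0$ (all terms with non-integer exponent are discarded). For a positive rational number $r$ and an integer $k\geq 0$, set $$G_{r,k}(q):=\frac{(q^{r+1};q)_k}{(q;q)_k}\in\mathcal{P},\qquad \mathcal{T}_{r,k}(q):=\operatorname{Tr}_{\mathbb{Z}}(G_{r,k}(q))\in\mathbb{Z}[[q]].$$ For $F,G\in\mathbb{Q}[[q]]$, write $F\succeq_q G$ if for every integer $n\geq 0$ the coefficient of $q^n$ in $F-G$ is $\geq 0$. *)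

theory Defs
  imports "HOL-Computational_Algebra.Formal_Power_Series"
begin
text \<open>
  An element of \<open>P = (UN M >= 1. Q[[q^(1/M)]])\<close> is represented by its coefficient function
  \<open>alpha |-> c alpha\<close> on rational exponents, whose support lies in \<open>(1/M) Z_{>=0}\<close> for some
  \<open>M >= 1\<close>.
\<close>

typedef fracps = "{c :: rat \<Rightarrow> rat. \<exists>M::nat. M > 0 \<and> (\<forall>\<alpha>. c \<alpha> \<noteq> 0 \<longrightarrow> \<alpha> * of_nat M \<in> \<nat>)}"
  morphisms fracps_nth Abs_fracps
  by (rule exI[of _ "\<lambda>_. 0"]) auto

setup_lifting type_definition_fracps

lemma fracps_eqI: "(\<And>\<alpha>. fracps_nth F \<alpha> = fracps_nth G \<alpha>) \<Longrightarrow> F = G"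
  by transfer auto

lemma fracps_support:
  obtains M :: nat where "M > 0" "\<And>\<alpha>. fracps_nth F \<alpha> \<noteq> 0 \<Longrightarrow> \<alpha> * of_nat M \<in> \<nat>"
  using fracps_nth[of F] by auto

lemma mult_of_nat_in_Nats:
  fixes \<alpha> :: rat
  assumes "\<alpha> * of_nat M \<in> \<nat>"
  shows "\<alpha> * of_nat (M * N) \<in> \<nat>" "\<alpha> * of_nat (N * M) \<in> \<nat>"
proof -
  have "\<alpha> * of_nat M * of_nat N \<in> \<nat>"
    using assms by (rule Nats_mult[OF _ of_nat_in_Nats])
  then show "\<alpha> * of_nat (M * N) \<in> \<nat>" "\<alpha> * of_nat (N * M) \<in> \<nat>"
    unfolding of_nat_mult by (simp_all only: mult_ac)
qed

text \<open>
  The sum defining a coefficient of a product ranges over the exponents that contribute a nonzero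
  term; there are finitely many of them.
\<close>

instantiation fracps :: "{zero, one, plus, uminus, minus, times}"
begin

lift_definition zero_fracps :: fracps is "\<lambda>_. 0"
  by auto

lift_definition one_fracps :: fracps is "\<lambda>\<alpha>. if \<alpha> = 0 then 1 else 0"
  by auto

lift_definition plus_fracps :: "fracps \<Rightarrow> fracps \<Rightarrow> fracps" is "\<lambda>f g \<alpha>. f \<alpha> + g \<alpha>"
proof -
  fix f g :: "rat \<Rightarrow> rat"
  assume "\<exists>M::nat. M > 0 \<and> (\<forall>\<alpha>. f \<alpha> \<noteq> 0 \<longrightarrow> \<alpha> * of_nat M \<in> \<nat>)"
    and "\<exists>M::nat. M > 0 \<and> (\<forall>\<alpha>. g \<alpha> \<noteq> 0 \<longrightarrow> \<alpha> * of_nat M \<in> \<nat>)"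
  then obtain M N :: nat where "M > 0" "N > 0"
    and M: "\<And>\<alpha>. f \<alpha> \<noteq> 0 \<Longrightarrow> \<alpha> * of_nat M \<in> \<nat>"
    and N: "\<And>\<alpha>. g \<alpha> \<noteq> 0 \<Longrightarrow> \<alpha> * of_nat N \<in> \<nat>"
    by blast
  have "\<alpha> * of_nat (M * N) \<in> \<nat>" if "f \<alpha> + g \<alpha> \<noteq> 0" for \<alpha>
    using that M[of \<alpha>] N[of \<alpha>] mult_of_nat_in_Nats[of \<alpha>] by (cases "f \<alpha> = 0") auto
  with \<open>M > 0\<close> \<open>N > 0\<close>
  show "\<exists>M::nat. M > 0 \<and> (\<forall>\<alpha>. f \<alpha> + g \<alpha> \<noteq> 0 \<longrightarrow> \<alpha> * of_nat M \<in> \<nat>)"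
    by (intro exI[of _ "M * N"]) auto
qed

lift_definition uminus_fracps :: "fracps \<Rightarrow> fracps" is "\<lambda>f \<alpha>. - f \<alpha>"
  by auto

definition minus_fracps :: "fracps \<Rightarrow> fracps \<Rightarrow> fracps" where
  "F - G = F + - (G :: fracps)"

lift_definition times_fracps :: "fracps \<Rightarrow> fracps \<Rightarrow> fracps"
  is "\<lambda>f g \<gamma>. \<Sum>\<alpha> | f \<alpha> \<noteq> 0 \<and> g (\<gamma> - \<alpha>) \<noteq> 0. f \<alpha> * g (\<gamma> - \<alpha>)"
proof -
  fix f g :: "rat \<Rightarrow> rat"
  assume "\<exists>M::nat. M > 0 \<and> (\<forall>\<alpha>. f \<alpha> \<noteq> 0 \<longrightarrow> \<alpha> * of_nat M \<in> \<nat>)"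
    and "\<exists>M::nat. M > 0 \<and> (\<forall>\<alpha>. g \<alpha> \<noteq> 0 \<longrightarrow> \<alpha> * of_nat M \<in> \<nat>)"
  then obtain M N :: nat where "M > 0" "N > 0"
    and M: "\<And>\<alpha>. f \<alpha> \<noteq> 0 \<Longrightarrow> \<alpha> * of_nat M \<in> \<nat>"
    and N: "\<And>\<alpha>. g \<alpha> \<noteq> 0 \<Longrightarrow> \<alpha> * of_nat N \<in> \<nat>"
    by blast
  have "\<gamma> * of_nat (M * N) \<in> \<nat>"
    if nz: "(\<Sum>\<alpha> | f \<alpha> \<noteq> 0 \<and> g (\<gamma> - \<alpha>) \<noteq> 0. f \<alpha> * g (\<gamma> - \<alpha>)) \<noteq> 0" for \<gamma>
  proof -
    obtain \<alpha> where "f \<alpha> \<noteq> 0" "g (\<gamma> - \<alpha>) \<noteq> 0"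
      using nz by (rule sum.not_neutral_contains_not_neutral) blast
    then have "\<alpha> * of_nat (M * N) + (\<gamma> - \<alpha>) * of_nat (M * N) \<in> \<nat>"
      by (intro Nats_add mult_of_nat_in_Nats(1)[OF M] mult_of_nat_in_Nats(2)[OF N])
    moreover have "\<alpha> * of_nat (M * N) + (\<gamma> - \<alpha>) * of_nat (M * N) = \<gamma> * of_nat (M * N)"
      by (simp add: distrib_right[symmetric] del: of_nat_mult)
    ultimately show ?thesis
      by (simp only:)
  qed
  with \<open>M > 0\<close> \<open>N > 0\<close>
  show "\<exists>M::nat. M > 0 \<and> (\<forall>\<gamma>. (\<Sum>\<alpha> | f \<alpha> \<noteq> 0 \<and> g (\<gamma> - \<alpha>) \<noteq> 0. f \<alpha> * g (\<gamma> - \<alpha>)) \<noteq> 0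
      \<longrightarrow> \<gamma> * of_nat M \<in> \<nat>)"
    by (intro exI[of _ "M * N"]) auto
qed

instance ..

end

text \<open>
  \<open>fracps_of_fps M f\<close> is \<open>f(q^(1/M))\<close>, i.e. the inclusion of \<open>Q[[q^(1/M)]]\<close> into the union.
\<close>

lift_definition fracps_of_fps :: "nat \<Rightarrow> rat fps \<Rightarrow> fracps"
  is "\<lambda>M f \<alpha>. if M > 0 \<and> \<alpha> * of_nat M \<in> \<nat> then fps_nth f (nat \<lfloor>\<alpha> * of_nat M\<rfloor>) else 0"
proof -
  fix M :: nat and f :: "rat fps"
  show "\<exists>N::nat. N > 0 \<and> (\<forall>\<alpha>. (if M > 0 \<and> \<alpha> * of_nat M \<in> \<nat>
      then fps_nth f (nat \<lfloor>\<alpha> * of_nat M\<rfloor>) else 0) \<noteq> 0 \<longrightarrow> \<alpha> * of_nat N \<in> \<nat>)"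
    by (cases "M > 0") auto
qed

lemma fracps_nth_of_fps:
  "M > 0 \<Longrightarrow> fracps_nth (fracps_of_fps M f) (of_nat n / of_nat M) = fps_nth f n"
  by transfer auto

lemma fracps_nth_of_fps_eq_0:
  "\<alpha> * of_nat M \<notin> \<nat> \<Longrightarrow> fracps_nth (fracps_of_fps M f) \<alpha> = 0"
  by transfer auto

lemma exponent_in_lattice:
  fixes \<alpha> :: rat
  assumes "M > 0" "\<alpha> * of_nat M \<in> \<nat>"
  shows "\<exists>n. \<alpha> = of_nat n / of_nat M"
proof -
  obtain n where "\<alpha> * of_nat M = of_nat n"
    using assms(2) by (auto elim: Nats_cases)
  then have "\<alpha> = of_nat n / of_nat M"
    using assms(1) by (simp add: field_simps)
  then show ?thesis ..
qed

lemma exponent_cases: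
  fixes \<alpha> :: rat
  assumes "M > 0"
  obtains n :: nat where "\<alpha> = of_nat n / of_nat M" | "\<alpha> * of_nat M \<notin> \<nat>"
  using exponent_in_lattice[OF assms] by blast

lemma fracps_of_fps_1: "M > 0 \<Longrightarrow> fracps_of_fps M 1 = 1"
proof (rule fracps_eqI)
  fix \<alpha> assume M: "M > 0"
  show "fracps_nth (fracps_of_fps M 1) \<alpha> = fracps_nth 1 \<alpha>"
    by (rule exponent_cases[OF M, of \<alpha>])
      (use M in \<open>auto simp: fracps_nth_of_fps fracps_nth_of_fps_eq_0 one_fracps.rep_eq\<close>)
qed

lemma fracps_of_fps_add:
  "M > 0 \<Longrightarrow> fracps_of_fps M (f + g) = fracps_of_fps M f + fracps_of_fps M g"
  by transfer auto

lemma fracps_of_fps_mult: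
  assumes M: "M > 0"
  shows "fracps_of_fps M (f * g) = fracps_of_fps M f * fracps_of_fps M g"
proof (rule fracps_eqI)
  fix \<gamma> :: rat
  let ?F = "fracps_nth (fracps_of_fps M f)" and ?G = "fracps_nth (fracps_of_fps M g)"
  let ?S = "{\<alpha>. ?F \<alpha> \<noteq> 0 \<and> ?G (\<gamma> - \<alpha>) \<noteq> 0}"
  have prod: "fracps_nth (fracps_of_fps M f * fracps_of_fps M g) \<gamma> =
      (\<Sum>\<alpha>\<in>?S. ?F \<alpha> * ?G (\<gamma> - \<alpha>))"
    by (simp add: times_fracps.rep_eq)
  have S_nat: "\<exists>i j. \<alpha> = of_nat i / of_nat M \<and> \<gamma> - \<alpha> = of_nat j / of_nat M" if "\<alpha> \<in> ?S" for \<alpha>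
  proof -
    have "\<alpha> * of_nat M \<in> \<nat>" "(\<gamma> - \<alpha>) * of_nat M \<in> \<nat>"
      using that fracps_nth_of_fps_eq_0 by blast+
    then show ?thesis
      using exponent_in_lattice[OF M] by blast
  qed
  show "fracps_nth (fracps_of_fps M (f * g)) \<gamma> =
      fracps_nth (fracps_of_fps M f * fracps_of_fps M g) \<gamma>"
  proof (cases rule: exponent_cases[OF M, of \<gamma>])
    case (1 n)
    have diff: "\<gamma> - of_nat i / of_nat M = of_nat (n - i) / of_nat M" if "i \<le> n" for i
      using that by (simp add: 1 of_nat_diff diff_divide_distrib)
    let ?h = "\<lambda>i. (of_nat i :: rat) / of_nat M"
    have inj: "inj_on ?h {0..n}"
      using M by (auto simp: inj_on_def)
    have sub: "?S \<subseteq> ?h ` {0..n}"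
    proof
      fix \<alpha> assume "\<alpha> \<in> ?S"
      then obtain i j where ij: "\<alpha> = ?h i" "\<gamma> - \<alpha> = ?h j"
        using S_nat by blast
      then have "(of_nat n :: rat) = of_nat (i + j)"
        using M by (simp add: 1 field_simps)
      then have "n = i + j"
        by (simp only: of_nat_eq_iff)
      then have "i \<le> n"
        by simp
      then show "\<alpha> \<in> ?h ` {0..n}"
        using ij by auto
    qed
    have "(\<Sum>\<alpha>\<in>?S. ?F \<alpha> * ?G (\<gamma> - \<alpha>)) = (\<Sum>\<alpha>\<in>?h ` {0..n}. ?F \<alpha> * ?G (\<gamma> - \<alpha>))"
      using sub by (intro sum.mono_neutral_left) auto
    also have "\<dots> = (\<Sum>i=0..n. ?F (?h i) * ?G (\<gamma> - ?h i))"
      using inj by (simp add: sum.reindex)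
    also have "\<dots> = (\<Sum>i=0..n. fps_nth f i * fps_nth g (n - i))"
      using M by (intro sum.cong refl) (simp add: diff fracps_nth_of_fps del: of_nat_diff)
    also have "\<dots> = fracps_nth (fracps_of_fps M (f * g)) \<gamma>"
      using M by (simp add: 1 fracps_nth_of_fps fps_mult_nth)
    finally show ?thesis
      using prod by metis
  next
    case 2
    have "?S = {}"
    proof (rule ccontr)
      assume "?S \<noteq> {}"
      then obtain \<alpha> where "\<alpha> \<in> ?S" by blast
      then obtain i j where "\<alpha> = of_nat i / of_nat M" "\<gamma> - \<alpha> = of_nat j / of_nat M"
        using S_nat by blast
      then have "\<gamma> * of_nat M = of_nat (i + j)"
        using M by (simp add: field_simps)
      then show False
        using 2 by (metis of_nat_in_Nats)
    qed
    then show ?thesis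
      using 2 by (simp add: prod fracps_nth_of_fps_eq_0 del: Collect_empty_eq)
  qed
qed

lemma fracps_eq_of_fps:
  assumes "M > 0" and "\<And>\<alpha>. fracps_nth F \<alpha> \<noteq> 0 \<Longrightarrow> \<alpha> * of_nat M \<in> \<nat>"
  shows "F = fracps_of_fps M (Abs_fps (\<lambda>n. fracps_nth F (of_nat n / of_nat M)))"
proof (rule fracps_eqI)
  fix \<alpha>
  show "fracps_nth F \<alpha> =
      fracps_nth (fracps_of_fps M (Abs_fps (\<lambda>n. fracps_nth F (of_nat n / of_nat M)))) \<alpha>"
    by (rule exponent_cases[OF assms(1), of \<alpha>])
      (use assms in \<open>auto simp: fracps_nth_of_fps fracps_nth_of_fps_eq_0\<close>)
qed

lemma fracps_common_denominator:
  obtains M f g h where "M > 0" "F = fracps_of_fps M f" "G = fracps_of_fps M g"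
    "H = fracps_of_fps M h"
proof -
  obtain K where K: "K > 0" "\<And>\<alpha>. fracps_nth F \<alpha> \<noteq> 0 \<Longrightarrow> \<alpha> * of_nat K \<in> \<nat>"
    using fracps_support[of F] by blast
  obtain L where L: "L > 0" "\<And>\<alpha>. fracps_nth G \<alpha> \<noteq> 0 \<Longrightarrow> \<alpha> * of_nat L \<in> \<nat>"
    using fracps_support[of G] by blast
  obtain N where N: "N > 0" "\<And>\<alpha>. fracps_nth H \<alpha> \<noteq> 0 \<Longrightarrow> \<alpha> * of_nat N \<in> \<nat>"
    using fracps_support[of H] by blast
  let ?M = "K * L * N"
  have "?M > 0"
    using K L N by simp
  moreover have "\<alpha> * of_nat ?M \<in> \<nat>" if "fracps_nth F \<alpha> \<noteq> 0" for \<alpha>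
    using K(2)[OF that] mult_of_nat_in_Nats by blast
  moreover have "\<alpha> * of_nat ?M \<in> \<nat>" if "fracps_nth G \<alpha> \<noteq> 0" for \<alpha>
    using L(2)[OF that] mult_of_nat_in_Nats by blast
  moreover have "\<alpha> * of_nat ?M \<in> \<nat>" if "fracps_nth H \<alpha> \<noteq> 0" for \<alpha>
    using N(2)[OF that] mult_of_nat_in_Nats by blast
  ultimately show ?thesis
    using that fracps_eq_of_fps by blast
qed

instance fracps :: comm_ring_1
proof
  fix F G H :: fracps
  obtain M f g h where M: "M > 0"
    and eqs: "F = fracps_of_fps M f" "G = fracps_of_fps M g" "H = fracps_of_fps M h"
    by (rule fracps_common_denominator)
  note hom = fracps_of_fps_mult[OF M, symmetric] fracps_of_fps_add[OF M, symmetric]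
    fracps_of_fps_1[OF M, symmetric]
  show "F * G * H = F * (G * H)" "F * G = G * F" "1 * F = F" "(F + G) * H = F * H + G * H"
    unfolding eqs hom by (simp_all add: algebra_simps)
  show "F + G + H = F + (G + H)" "F + G = G + F" "0 + F = F" "- F + F = 0"
    by (transfer; simp add: algebra_simps fun_eq_iff)+
  show "F - G = F + - G"
    by (rule minus_fracps_def)
  show "(0 :: fracps) \<noteq> 1"
    by transfer (auto simp: fun_eq_iff)
qed

text \<open>
  Division is multiplication by the ring inverse, with the inverse of a non-unit set to \<open>0\<close>.
\<close>

instantiation fracps :: inverse
begin

definition inverse_fracps :: "fracps \<Rightarrow> fracps" where
  "inverse (F :: fracps) = (if \<exists>G. F * G = 1 then THE G. F * G = 1 else 0)"

definition divide_fracps :: "fracps \<Rightarrow> fracps \<Rightarrow> fracps" where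
  "F div G = F * inverse (G :: fracps)"

instance ..

end

lemma fracps_inverse_unique:
  fixes F G :: fracps
  assumes "F * G = 1"
  shows "inverse F = G"
proof -
  have "(THE G. F * G = 1) = G"
  proof (rule the_equality)
    fix H assume "F * H = 1"
    have "H = (F * G) * H"
      by (simp add: assms)
    also have "\<dots> = G * (F * H)"
      by (simp only: mult_ac)
    finally show "H = G"
      by (simp add: \<open>F * H = 1\<close>)
  qed (rule assms)
  with assms show ?thesis
    unfolding inverse_fracps_def by auto
qed

text \<open>The monomial \<open>q^alpha\<close>; the value for \<open>alpha < 0\<close> is a dummy.\<close>

lift_definition qpow :: "rat \<Rightarrow> fracps"
  is "\<lambda>\<alpha> \<beta>. if \<alpha> \<ge> 0 \<and> \<beta> = \<alpha> then 1 else 0"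
proof -
  fix \<alpha> :: rat
  obtain a b where ab: "b > 0" "\<alpha> = of_int a / of_int b"
    by (metis Fract_of_int_quotient Rat_cases)
  have "\<alpha> * of_nat (nat b) \<in> \<nat>" if "\<alpha> \<ge> 0"
  proof -
    have "\<alpha> * of_nat (nat b) = of_int a"
      using ab by simp
    moreover have "a \<ge> 0"
      using ab that by (simp add: zero_le_divide_iff)
    ultimately show ?thesis
      by (metis of_nat_in_Nats of_nat_nat)
  qed
  with ab show "\<exists>M::nat. M > 0 \<and> (\<forall>\<beta>. (if \<alpha> \<ge> 0 \<and> \<beta> = \<alpha> then 1 else 0 :: rat) \<noteq> 0
      \<longrightarrow> \<beta> * of_nat M \<in> \<nat>)"
    by (intro exI[of _ "nat b"]) auto
qed

definition qpochhammer :: "'a \<Rightarrow> 'a \<Rightarrow> nat \<Rightarrow> 'a :: comm_ring_1" where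
  "qpochhammer z q n = (\<Prod>j<n. 1 - z * q ^ j)"

definition integer_trace :: "fracps \<Rightarrow> rat fps" where
  "integer_trace F = Abs_fps (\<lambda>n. fracps_nth F (of_nat n))"

definition G_series :: "rat \<Rightarrow> nat \<Rightarrow> fracps" where
  "G_series r k = qpochhammer (qpow (r + 1)) (qpow 1) k / qpochhammer (qpow 1) (qpow 1) k"

definition T_series :: "rat \<Rightarrow> nat \<Rightarrow> rat fps" where
  "T_series r k = integer_trace (G_series r k)"

definition coeff_dominates :: "rat fps \<Rightarrow> rat fps \<Rightarrow> bool"  (infix "\<succeq>\<^sub>q" 50) where
  "F \<succeq>\<^sub>q G \<longleftrightarrow> (\<forall>n. fps_nth (F - G) n \<ge> 0)"

text \<open>
  The monomials multiply as expected, and the denominator of \<^const>\<open>G_series\<close> is a unit, so the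
  quotient there is a genuine one.
\<close>

lemma fracps_of_fps_X_power:
  assumes "M > 0"
  shows "fracps_of_fps M (fps_X ^ n) = qpow (of_nat n / of_nat M)"
proof (rule fracps_eqI)
  fix \<alpha>
  show "fracps_nth (fracps_of_fps M (fps_X ^ n)) \<alpha> = fracps_nth (qpow (of_nat n / of_nat M)) \<alpha>"
    by (rule exponent_cases[OF assms, of \<alpha>])
      (use assms in \<open>auto simp: fracps_nth_of_fps fracps_nth_of_fps_eq_0 qpow.rep_eq fps_X_power_nth\<close>)
qed

lemma qpow_common_denominator:
  fixes \<alpha> \<beta> :: rat
  assumes "\<alpha> \<ge> 0" "\<beta> \<ge> 0"
  obtains M m n :: nat where "M > 0" "\<alpha> = of_nat m / of_nat M" "\<beta> = of_nat n / of_nat M"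
proof -
  obtain K where K: "K > 0" "\<And>\<gamma>. fracps_nth (qpow \<alpha>) \<gamma> \<noteq> 0 \<Longrightarrow> \<gamma> * of_nat K \<in> \<nat>"
    using fracps_support[of "qpow \<alpha>"] by blast
  obtain L where L: "L > 0" "\<And>\<gamma>. fracps_nth (qpow \<beta>) \<gamma> \<noteq> 0 \<Longrightarrow> \<gamma> * of_nat L \<in> \<nat>"
    using fracps_support[of "qpow \<beta>"] by blast
  have KL: "K * L > 0"
    using K L by simp
  have "\<alpha> * of_nat (K * L) \<in> \<nat>"
    using assms K(2)[of \<alpha>] mult_of_nat_in_Nats by (simp add: qpow.rep_eq del: of_nat_mult)
  moreover have "\<beta> * of_nat (K * L) \<in> \<nat>"
    using assms L(2)[of \<beta>] mult_of_nat_in_Nats by (simp add: qpow.rep_eq del: of_nat_mult)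
  ultimately show ?thesis
    using that[OF KL] exponent_in_lattice[OF KL] by blast
qed

lemma qpow_0: "qpow 0 = 1"
  by transfer auto

lemma qpow_add:
  assumes "\<alpha> \<ge> 0" "\<beta> \<ge> 0"
  shows "qpow (\<alpha> + \<beta>) = qpow \<alpha> * qpow \<beta>"
proof -
  obtain M m n :: nat
    where M: "M > 0" and eqs: "\<alpha> = of_nat m / of_nat M" "\<beta> = of_nat n / of_nat M"
    using assms by (rule qpow_common_denominator)
  have "\<alpha> + \<beta> = of_nat (m + n) / of_nat M"
    by (simp add: eqs add_divide_distrib)
  then have "qpow (\<alpha> + \<beta>) = fracps_of_fps M (fps_X ^ (m + n))"
    using M by (simp only: fracps_of_fps_X_power)
  also have "\<dots> = qpow \<alpha> * qpow \<beta>"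
    using M by (simp only: power_add fracps_of_fps_mult fracps_of_fps_X_power eqs)
  finally show ?thesis .
qed

lemma fracps_of_fps_diff:
  assumes M: "M > 0"
  shows "fracps_of_fps M (f - g) = fracps_of_fps M f - fracps_of_fps M g"
  using fracps_of_fps_add[OF M, of "f - g" g] by simp

lemma fracps_of_fps_power:
  "M > 0 \<Longrightarrow> fracps_of_fps M (f ^ n) = fracps_of_fps M f ^ n"
  by (induction n) (simp_all add: fracps_of_fps_1 fracps_of_fps_mult)

lemma fracps_of_fps_qpochhammer:
  assumes M: "M > 0"
  shows "fracps_of_fps M (qpochhammer z q n) =
    qpochhammer (fracps_of_fps M z) (fracps_of_fps M q) n"
  unfolding qpochhammer_def
  using M by (induction n)
    (simp_all add: fracps_of_fps_1 fracps_of_fps_mult fracps_of_fps_diff fracps_of_fps_power)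

lemma fracps_of_fps_divide:
  assumes M: "M > 0" and "fps_nth g 0 \<noteq> 0"
  shows "fracps_of_fps M f / fracps_of_fps M g = fracps_of_fps M (f / g)"
proof -
  have "fracps_of_fps M g * fracps_of_fps M (inverse g) = 1"
    using assms
    by (simp add: fracps_of_fps_mult[symmetric] fracps_of_fps_1 inverse_mult_eq_1')
  then have "inverse (fracps_of_fps M g) = fracps_of_fps M (inverse g)"
    by (rule fracps_inverse_unique)
  then show ?thesis
    using assms by (simp add: divide_fracps_def fracps_of_fps_mult fps_divide_unit)
qed

lemma qpochhammer_fps_nth_0:
  fixes z q :: "rat fps"
  assumes "fps_nth z 0 = 0"
  shows "fps_nth (qpochhammer z q n) 0 = 1"
  unfolding qpochhammer_def using assms by (induction n) simp_all

lemma G_series_mult: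
  "G_series r k * qpochhammer (qpow 1) (qpow 1) k = qpochhammer (qpow (r + 1)) (qpow 1) k"
proof -
  let ?p = "qpochhammer fps_X fps_X k :: rat fps"
  have q: "qpow 1 = fracps_of_fps 1 fps_X"
    using fracps_of_fps_X_power[of 1 1] by simp
  have "fps_nth ?p 0 \<noteq> 0"
    by (simp add: qpochhammer_fps_nth_0)
  then have "qpochhammer (qpow 1) (qpow 1) k * fracps_of_fps 1 (inverse ?p) = 1"
    by (simp add: q fracps_of_fps_qpochhammer[symmetric] fracps_of_fps_mult[symmetric]
        fracps_of_fps_1 inverse_mult_eq_1')
  moreover from this have "inverse (qpochhammer (qpow 1) (qpow 1) k) = fracps_of_fps 1 (inverse ?p)"
    by (rule fracps_inverse_unique)
  ultimately have unit: "inverse (qpochhammer (qpow 1) (qpow 1) k) * qpochhammer (qpow 1) (qpow 1) k = 1"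
    by (simp only: mult.commute)
  show ?thesis
    unfolding G_series_def divide_fracps_def mult.assoc unit by simp
qed

end

theory Submission
  imports Defs
begin

text \<open>
  By the finite \<open>q\<close>-binomial theorem, \<open>G_{r,k}\<close> is the sum over \<open>j \<le> k\<close> of
  \<open>(-1)^j q^(j (r + 1) + j (j - 1) / 2) / ((q;q)_j (q;q)_{k-j})\<close>, and the trace keeps the terms
  with \<open>j r\<close> an integer. For \<open>r = 1/2\<close> these are exactly the terms with \<open>j\<close> even, all of them
  nonnegative; for other \<open>r\<close> the terms with \<open>j\<close> odd only decrease the trace. For \<open>j\<close> even and
  \<open>r \<ge> 1/2\<close>, the term for \<open>r\<close> is dominated by the term for \<open>1/2\<close>, because the coefficients of
  \<open>1 / ((q;q)_j (q;q)_{k-j})\<close> are nondecreasing when \<open>k \<ge> 1\<close>.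
\<close>

section \<open>The finite q-binomial theorem\<close>

lemma qpochhammer_0 [simp]: "qpochhammer z q 0 = 1"
  by (simp add: qpochhammer_def)

lemma qpochhammer_Suc: "qpochhammer z q (Suc n) = qpochhammer z q n * (1 - z * q ^ n)"
  by (simp add: qpochhammer_def)

text \<open>
  The \<open>q\<close>-binomial coefficient is written as \<open>(q;q)_k u_j u_{k-j}\<close> with \<open>u_j\<close> the inverse of
  \<open>(q;q)_j\<close>, so that no division is needed.
\<close>

lemma q_binomial_theorem:
  fixes q z :: "'a :: comm_ring_1" and u :: "nat \<Rightarrow> 'a"
  assumes u: "\<And>j. qpochhammer q q j * u j = 1"
  shows "qpochhammer z q k * u k =
    (\<Sum>j\<le>k. (- 1) ^ j * (z ^ j * q ^ (j choose 2)) * (u j * u (k - j)))"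
proof (induction k)
  case 0
  show ?case using u[of 0] by (simp add: numeral_2_eq_2)
next
  case (Suc k)
  let ?a = "\<lambda>j. (- 1) ^ j * (z ^ j * q ^ (j choose 2))"
  let ?S = "\<lambda>k. \<Sum>j\<le>k. ?a j * (u j * u (k - j))"
  have u_rec: "(1 - q ^ Suc j) * u (Suc j) = u j" for j
  proof -
    have "(1 - q ^ Suc j) * u (Suc j) = (qpochhammer q q j * u j) * ((1 - q ^ Suc j) * u (Suc j))"
      by (simp add: u)
    also have "\<dots> = u j * (qpochhammer q q (Suc j) * u (Suc j))"
      by (simp add: qpochhammer_Suc mult_ac)
    finally show ?thesis
      by (simp add: u)
  qed
  \<comment> \<open>In a general commutative ring \<open>1 - q ^ Suc k\<close> could be a zero
    divisor; this explicit inverse permits its cancellation at the end.\<close>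
  have unit: "(u (Suc k) * qpochhammer q q k) * (1 - q ^ Suc k) = 1"
    using u[of "Suc k"] by (simp add: qpochhammer_Suc mult_ac)
  \<comment> \<open>The term \<open>j = Suc k\<close> vanishes, since its factor is
    \<open>1 - q ^ 0\<close>.\<close>
  have fst_sum: "(\<Sum>j\<le>Suc k. ?a j * (u j * ((1 - q ^ (Suc k - j)) * u (Suc k - j)))) = ?S k"
    by (auto intro!: sum.cong simp: Suc_diff_le u_rec simp del: power_Suc)
  \<comment> \<open>Here the term \<open>j = 0\<close> vanishes, so the index can be shifted down by
    one; each shifted term gains the factor \<open>- (z * q ^ k)\<close>.\<close>
  have snd_sum: "(\<Sum>j\<le>Suc k. ?a j * (q ^ (Suc k - j) * ((1 - q ^ j) * u j) * u (Suc k - j)))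
      = - (z * q ^ k) * ?S k"
  proof -
    have "?a (Suc i) * q ^ (k - i) = - (z * q ^ k) * ?a i" if "i \<le> k" for i
    proof -
      have "Suc i choose 2 = i + (i choose 2)"
        by (simp add: numeral_2_eq_2)
      moreover have "q ^ k = q ^ i * q ^ (k - i)"
        using that by (simp flip: power_add)
      ultimately show ?thesis
        by (simp add: power_add mult_ac)
    qed
    then have "?a (Suc i) * (q ^ (k - i) * u i * u (k - i)) =
        - (z * q ^ k) * (?a i * (u i * u (k - i)))" if "i \<le> k" for i
      using that by (metis (no_types, lifting) mult.assoc)
    then show ?thesis
      by (subst sum.atMost_Suc_shift)
        (auto simp: u_rec sum_distrib_left simp del: power_Suc intro!: sum.cong)
  qed
  \<comment> \<open>A q-Pascal step: \<open>1 - q ^ Suc k\<close> is split into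
    \<open>1 - q ^ (Suc k - j)\<close> and \<open>q ^ (Suc k - j) * (1 - q ^ j)\<close>, and each
    part lowers the index of one factor \<open>u\<close>.\<close>
  have "(1 - q ^ Suc k) * ?S (Suc k) =
      (\<Sum>j\<le>Suc k. ?a j * (u j * ((1 - q ^ (Suc k - j)) * u (Suc k - j)))) +
      (\<Sum>j\<le>Suc k. ?a j * (q ^ (Suc k - j) * ((1 - q ^ j) * u j) * u (Suc k - j)))"
    unfolding sum_distrib_left sum.distrib[symmetric]
  proof (intro sum.cong refl)
    fix j assume "j \<in> {..Suc k}"
    then have "q ^ Suc k = q ^ (Suc k - j) * q ^ j"
      by (simp only: power_add[symmetric]) simp
    then show "(1 - q ^ Suc k) * (?a j * (u j * u (Suc k - j))) =
        ?a j * (u j * ((1 - q ^ (Suc k - j)) * u (Suc k - j))) +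
        ?a j * (q ^ (Suc k - j) * ((1 - q ^ j) * u j) * u (Suc k - j))"
      by (simp only:) (simp add: algebra_simps del: power_Suc)
  qed
  also have "\<dots> = (1 - z * q ^ k) * ?S k"
    unfolding fst_sum snd_sum by (simp add: algebra_simps)
  also have "\<dots> = qpochhammer z q (Suc k) * u k"
    unfolding Suc.IH[symmetric] by (simp add: qpochhammer_Suc mult_ac)
  also have "\<dots> = (1 - q ^ Suc k) * (qpochhammer z q (Suc k) * u (Suc k))"
    by (simp only: u_rec[of k, symmetric] mult_ac)
  finally have "(u (Suc k) * qpochhammer q q k) * ((1 - q ^ Suc k) * ?S (Suc k)) =
    (u (Suc k) * qpochhammer q q k) * ((1 - q ^ Suc k) * (qpochhammer z q (Suc k) * u (Suc k)))"
    by (rule arg_cong)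
  then show ?case
    by (simp only: mult.assoc[symmetric] unit) simp
qed

section \<open>Nonnegative and nondecreasing coefficients\<close>

definition nonneg_coeffs :: "rat fps \<Rightarrow> bool" where
  "nonneg_coeffs f \<longleftrightarrow> (\<forall>n. 0 \<le> fps_nth f n)"

lemma nonneg_coeffs_1: "nonneg_coeffs 1"
  by (simp add: nonneg_coeffs_def)

lemma nonneg_coeffs_mult: "nonneg_coeffs f \<Longrightarrow> nonneg_coeffs g \<Longrightarrow> nonneg_coeffs (f * g)"
  by (simp add: nonneg_coeffs_def fps_mult_nth sum_nonneg)

lemma nonneg_coeffs_inverse_one_minus_X_power:
  assumes "m > 0"
  shows "nonneg_coeffs (inverse (1 - fps_X ^ m))"
proof -
  \<comment> \<open>The geometric series in \<open>fps_X ^ m\<close>.\<close>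
  let ?g = "Abs_fps (\<lambda>n. if m dvd n then 1 else 0) :: rat fps"
  have "(1 - fps_X ^ m) * ?g = 1"
  proof (rule fps_ext)
    fix n
    have "\<not> m dvd n" if "0 < n" "n < m"
      using that by (meson dvd_imp_le leD)
    then show "fps_nth ((1 - fps_X ^ m) * ?g) n = fps_nth 1 n"
      using assms by (auto simp: left_diff_distrib fps_X_power_mult_nth dvd_minus_self)
  qed
  then have "inverse (1 - fps_X ^ m) = ?g"
    by (rule fps_inverse_unique)
  then show ?thesis
    by (simp add: nonneg_coeffs_def)
qed

text \<open>The generating function of partitions into parts of size at most
  \<open>j\<close>.\<close>

definition inv_qfact :: "nat \<Rightarrow> rat fps" where
  "inv_qfact j = inverse (qpochhammer fps_X fps_X j)"

lemma inv_qfact_0: "inv_qfact 0 = 1"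
  by (simp add: inv_qfact_def)

lemma inv_qfact_Suc: "inv_qfact (Suc j) = inv_qfact j * inverse (1 - fps_X ^ Suc j)"
  by (simp add: inv_qfact_def qpochhammer_Suc fps_inverse_mult)

lemma qpochhammer_mult_inv_qfact: "qpochhammer fps_X fps_X j * inv_qfact j = 1"
  unfolding inv_qfact_def by (rule inverse_mult_eq_1') (simp add: qpochhammer_fps_nth_0)

lemma nonneg_coeffs_inv_qfact: "nonneg_coeffs (inv_qfact j)"
  by (induction j)
    (auto simp: inv_qfact_0 inv_qfact_Suc nonneg_coeffs_1
      simp del: power_Suc intro!: nonneg_coeffs_mult nonneg_coeffs_inverse_one_minus_X_power)

text \<open>The factor \<open>1 - fps_X\<close> cancels against the first factor of the denominator,
  which is present because the index is a successor; a product of geometric series remains.\<close>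

lemma nonneg_coeffs_diff_inv_qfact:
  "nonneg_coeffs ((1 - fps_X) * inv_qfact (Suc j))"
proof (induction j)
  case 0
  have "(1 - fps_X) * inverse (1 - fps_X :: rat fps) = 1"
    by (rule inverse_mult_eq_1') simp
  then show ?case
    by (simp add: inv_qfact_Suc inv_qfact_0 nonneg_coeffs_1)
next
  case (Suc j)
  then show ?case
    unfolding inv_qfact_Suc[of "Suc j"] mult.assoc[symmetric]
    by (rule nonneg_coeffs_mult[OF _ nonneg_coeffs_inverse_one_minus_X_power]) simp_all
qed

text \<open>Multiplication by \<open>1 - fps_X\<close> takes successive differences of
  coefficients.\<close>

lemma mono_coeffs:
  assumes "nonneg_coeffs ((1 - fps_X) * f)"
  shows "mono (fps_nth f)"
proof (rule mono_iff_le_Suc[THEN iffD2], intro allI)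
  fix n
  have "0 \<le> fps_nth ((1 - fps_X) * f) (Suc n)"
    using assms by (simp add: nonneg_coeffs_def)
  then show "fps_nth f n \<le> fps_nth f (Suc n)"
    by (simp add: left_diff_distrib)
qed

text \<open>As \<open>k \<ge> 1\<close>, one of \<open>j\<close> and \<open>k - j\<close> is
  positive, and that factor absorbs \<open>1 - fps_X\<close>.\<close>

lemma mono_inv_qfact_mult:
  assumes "k \<ge> 1" "j \<le> k"
  shows "mono (fps_nth (inv_qfact j * inv_qfact (k - j)))"
proof (rule mono_coeffs, cases j)
  case 0
  then obtain i where "k - j = Suc i"
    using assms by (cases k) auto
  with 0 show "nonneg_coeffs ((1 - fps_X) * (inv_qfact j * inv_qfact (k - j)))"
    using nonneg_coeffs_diff_inv_qfact[of i] by (simp add: inv_qfact_0)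
next
  case (Suc i)
  show "nonneg_coeffs ((1 - fps_X) * (inv_qfact j * inv_qfact (k - j)))"
    unfolding mult.assoc[symmetric]
    by (rule nonneg_coeffs_mult[OF _ nonneg_coeffs_inv_qfact])
      (simp add: Suc nonneg_coeffs_diff_inv_qfact)
qed

section \<open>Computing integer traces\<close>

lemma qpow_power: "\<alpha> \<ge> 0 \<Longrightarrow> qpow \<alpha> ^ n = qpow (of_nat n * \<alpha>)"
  by (induction n) (simp_all add: qpow_0 qpow_add[symmetric] algebra_simps)

lemma integer_trace_add: "integer_trace (F + G) = integer_trace F + integer_trace G"
  by (rule fps_ext) (simp add: integer_trace_def plus_fracps.rep_eq)

lemma integer_trace_uminus: "integer_trace (- F) = - integer_trace F"
  by (rule fps_ext) (simp add: integer_trace_def uminus_fracps.rep_eq)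

lemma integer_trace_sum: "integer_trace (sum f A) = (\<Sum>x\<in>A. integer_trace (f x))"
proof (induction A rule: infinite_finite_induct)
  case empty
  show ?case by (rule fps_ext) (simp add: integer_trace_def zero_fracps.rep_eq)
next
  case (infinite A)
  then show ?case by (intro fps_ext) (simp add: integer_trace_def zero_fracps.rep_eq)
qed (simp add: integer_trace_add)

lemma integer_trace_sign_mult:
  "integer_trace ((- 1) ^ j * F) = (- 1) ^ j * integer_trace F"
  by (cases "even j") (simp_all add: integer_trace_uminus)

text \<open>Multiplication by \<open>qpow e\<close> shifts all exponents by \<open>e\<close>. The
  other factor has integer exponents only, so a non-integer \<open>e\<close> leaves nothing for the
  trace to keep.\<close>

lemma integer_trace_qpow_mult_nth:
  assumes "e \<ge> 0"
  shows "fps_nth (integer_trace (qpow e * fracps_of_fps 1 f)) n =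
    (if e \<in> \<nat> \<and> e \<le> of_nat n then fps_nth f (n - nat \<lfloor>e\<rfloor>) else 0)"
proof -
  let ?F = "fracps_nth (fracps_of_fps 1 f)"
  let ?S = "{\<alpha>. fracps_nth (qpow e) \<alpha> \<noteq> 0 \<and> ?F (of_nat n - \<alpha>) \<noteq> 0}"
  have "fps_nth (integer_trace (qpow e * fracps_of_fps 1 f)) n =
      (\<Sum>\<alpha>\<in>?S. fracps_nth (qpow e) \<alpha> * ?F (of_nat n - \<alpha>))"
    by (simp add: integer_trace_def times_fracps.rep_eq)
  also have "\<dots> = (\<Sum>\<alpha>\<in>{e}. fracps_nth (qpow e) \<alpha> * ?F (of_nat n - \<alpha>))"
    using assms by (intro sum.mono_neutral_left) (auto simp: qpow.rep_eq)
  also have "\<dots> = ?F (of_nat n - e)"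
    using assms by (simp add: qpow.rep_eq)
  also have "\<dots> = (if e \<in> \<nat> \<and> e \<le> of_nat n then fps_nth f (n - nat \<lfloor>e\<rfloor>) else 0)"
  proof (cases "of_nat n - e \<in> \<nat>")
    case True
    then obtain m where m: "of_nat n - e = of_nat m"
      by (auto elim: Nats_cases)
    then have "(of_nat m :: rat) \<le> of_nat n"
      using assms by linarith
    then have "m \<le> n"
      by simp
    with m have e: "e = of_nat (n - m)"
      by (simp add: of_nat_diff)
    have "n - (n - m) = m"
      using \<open>m \<le> n\<close> by simp
    moreover have "?F (of_nat n - e) = fps_nth f m"
      unfolding m using fracps_nth_of_fps[of 1 f m] by simp
    ultimately show ?thesis
      unfolding e by (simp del: of_nat_diff)
  next
    case False
    have "\<not> (e \<in> \<nat> \<and> e \<le> of_nat n)"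
    proof
      assume e: "e \<in> \<nat> \<and> e \<le> of_nat n"
      then obtain m where "e = of_nat m"
        by (auto elim: Nats_cases)
      with e have "of_nat n - e = of_nat (n - m)"
        by (simp add: of_nat_diff)
      with False show False
        by (metis of_nat_in_Nats)
    qed
    with False show ?thesis
      by (auto simp: fracps_nth_of_fps_eq_0)
  qed
  finally show ?thesis .
qed

section \<open>The trace as an alternating sum\<close>

definition trace_exponent :: "rat \<Rightarrow> nat \<Rightarrow> rat" where
  "trace_exponent r j = of_nat j * (r + 1) + of_nat (j choose 2)"

text \<open>The coefficient of \<open>q^n\<close> in the trace of the \<open>j\<close>-th q-binomial
  summand, without its sign.\<close>

definition trace_term :: "rat \<Rightarrow> nat \<Rightarrow> nat \<Rightarrow> nat \<Rightarrow> rat" where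
  "trace_term r k n j =
    (if trace_exponent r j \<in> \<nat> \<and> trace_exponent r j \<le> of_nat n
     then fps_nth (inv_qfact j * inv_qfact (k - j)) (n - nat \<lfloor>trace_exponent r j\<rfloor>) else 0)"

text \<open>The q-binomial theorem at \<open>z = qpow (r + 1)\<close>;
  \<open>trace_exponent r j\<close> collects the exponents of
  \<open>z ^ j * q ^ (j choose 2)\<close>.\<close>

lemma G_series_expansion:
  assumes "r \<ge> 0"
  shows "G_series r k = (\<Sum>j\<le>k. (- 1) ^ j *
    (qpow (trace_exponent r j) * fracps_of_fps 1 (inv_qfact j * inv_qfact (k - j))))"
proof -
  have q: "qpow 1 = fracps_of_fps 1 fps_X"
    using fracps_of_fps_X_power[of 1 1] by simp
  let ?u = "\<lambda>j. fracps_of_fps 1 (inv_qfact j)"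
  have u: "qpochhammer (qpow 1) (qpow 1) j * ?u j = 1" for j
    by (simp add: q fracps_of_fps_qpochhammer[symmetric] fracps_of_fps_mult[symmetric]
        qpochhammer_mult_inv_qfact fracps_of_fps_1)
  have "qpow (r + 1) ^ j * qpow 1 ^ (j choose 2) = qpow (trace_exponent r j)" for j
    using assms by (simp add: qpow_power qpow_add[symmetric] trace_exponent_def)
  moreover have "G_series r k = qpochhammer (qpow (r + 1)) (qpow 1) k * ?u k"
    unfolding G_series_def divide_fracps_def by (simp only: fracps_inverse_unique[OF u])
  ultimately show ?thesis
    using q_binomial_theorem[of "qpow 1" ?u "qpow (r + 1)" k, OF u]
    by (simp add: fracps_of_fps_mult mult_ac)
qed

lemma T_series_nth:
  assumes "r \<ge> 0"
  shows "fps_nth (T_series r k) n = (\<Sum>j\<le>k. (- 1) ^ j * trace_term r k n j)"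
proof -
  have "trace_exponent r j \<ge> 0" for j
    using assms by (simp add: trace_exponent_def)
  moreover have "fps_nth ((- 1) ^ j * f) n = (- 1) ^ j * fps_nth f n" for j and f :: "rat fps"
    by (cases "even j") simp_all
  ultimately show ?thesis
    unfolding T_series_def G_series_expansion[OF assms] integer_trace_sum integer_trace_sign_mult
    by (simp add: fps_sum_nth integer_trace_qpow_mult_nth trace_term_def del: One_nat_def)
qed

section \<open>Termwise comparison with \<open>r = 1/2\<close>\<close>

lemma trace_term_nonneg: "trace_term r k n j \<ge> 0"
  using nonneg_coeffs_mult[OF nonneg_coeffs_inv_qfact nonneg_coeffs_inv_qfact]
  by (simp add: trace_term_def nonneg_coeffs_def)

text \<open>Twice the exponent is \<open>3 * j + 2 * (j choose 2)\<close>, which is odd.\<close>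

lemma trace_term_half_odd:
  assumes "odd j"
  shows "trace_term (1 / 2) k n j = 0"
proof -
  have "trace_exponent (1 / 2) j \<notin> \<nat>"
  proof
    assume "trace_exponent (1 / 2) j \<in> \<nat>"
    then obtain m where "trace_exponent (1 / 2) j = of_nat m"
      by (auto elim: Nats_cases)
    then have "(of_nat (3 * j + 2 * (j choose 2)) :: rat) = of_nat (2 * m)"
      by (simp add: trace_exponent_def field_simps)
    then have "3 * j + 2 * (j choose 2) = 2 * m"
      by (simp only: of_nat_eq_iff)
    then have "even (3 * j + 2 * (j choose 2))"
      by simp
    then show False
      using assms by simp
  qed
  then show ?thesis
    by (simp add: trace_term_def)
qed

text \<open>For even \<open>j\<close> the exponent at \<open>1/2\<close> is an integer and at most
  the one at \<open>r\<close>, so the same nondecreasing coefficient sequence is read at an index at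
  least as large.\<close>

lemma trace_term_le_half:
  assumes "r \<ge> 1 / 2" "k \<ge> 1" "j \<le> k" "even j"
  shows "trace_term r k n j \<le> trace_term (1 / 2) k n j"
proof (cases "trace_exponent r j \<in> \<nat> \<and> trace_exponent r j \<le> of_nat n")
  case False
  then have "trace_term r k n j = 0"
    by (auto simp: trace_term_def)
  then show ?thesis
    using trace_term_nonneg by simp
next
  case True
  obtain i where "j = 2 * i"
    using \<open>even j\<close> by blast
  then have "trace_exponent (1 / 2) j = of_nat (3 * i + (j choose 2))"
    by (simp add: trace_exponent_def)
  then have nat: "trace_exponent (1 / 2) j \<in> \<nat>"
    by (metis of_nat_in_Nats)
  have le: "trace_exponent (1 / 2) j \<le> trace_exponent r j"
    unfolding trace_exponent_def using assms(1)
    by (intro add_right_mono mult_left_mono) simp_all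
  then have "n - nat \<lfloor>trace_exponent r j\<rfloor> \<le> n - nat \<lfloor>trace_exponent (1 / 2) j\<rfloor>"
    by (intro diff_le_mono2 nat_mono floor_mono)
  then show ?thesis
    using True nat le monoD[OF mono_inv_qfact_mult[OF assms(2,3)]]
    by (simp add: trace_term_def)
qed

theorem corollary1p4:
  fixes r :: rat and k :: nat
  assumes "r \<ge> 1 / 2" and "k \<ge> 1"
  shows "T_series (1 / 2) k \<succeq>\<^sub>q T_series r k"
proof -
  \<comment> \<open>For odd \<open>j\<close> the right side is 0 and the left side is the negative
    of a nonnegative term.\<close>
  have "(- 1) ^ j * trace_term r k n j \<le> (- 1) ^ j * trace_term (1 / 2) k n j"
    if "j \<le> k" for j n
    using assms that trace_term_le_half[of r k j n]
    by (cases "even j") (simp_all add: trace_term_half_odd trace_term_nonneg)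
  then show ?thesis
    using assms by (auto simp: coeff_dominates_def T_series_nth intro!: sum_mono)
qed

end
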